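(* Let $\mathcal V_{W\dot W}$ be a genaut and let $\mathcal V_W$ be controlled invariant in $\mathcal V_{W\dot W}$. Then 1. $\mathcal V_W\subseteq\mathcal V_{W\dot W}\circ W$. 2. If $\mathcal V_{W\dot W}$ is an LSG, then $\mathcal V_{W\dot W}\cap(\mathcal V_W\oplus(\mathcal V_W)_{\dot W})$ is a genop.
   Context: Fix a field $\mathbb F$; all index sets are finite. A vector on $X$ is a function $X\to\mathbb F$. $W,\dot W$ are disjoint sets that are copies of each other (in bijection); subscripts such as $(\mathcal V_W)_{\dot W}$ denote transport along the bijection. A genaut $\mathcal V_{W\dot W}$ is a linear subspace of vectors $(f_W,g_{\dot W})$ on $W\uplus\dot W$. For disjoint $X,Y$: $\mathcal V_{XY}\circ X:=\{f_X:(f_X,g_Y)\in\mathcal V_{XY}\text{ for some }g_Y\}$, $\mathcal V_{XY}\times X:=\{f_X:(f_X,0_Y)\in\mathcal V_{XY}\}$, $\mathcal V_{XY}\leftrightarrow\mathcal V_Y:=\{f_X:\exists g_Y\in\mathcal V_Y,\ (f_X,g_Y)\in\mathcal V_{XY}\}$. $\mathcal V_X\oplus\mathcal V_Y:=\{(f_X,g_Y):f_X\in\mathcal V_X,g_Y\in\mathcal V_Y\}$. A genaut is a USG if $\mathcal V_{W\dot W}\circ W\supseteq(\mathcal V_{W\dot W}\circ\dot W)_W$; an LSG if $\mathcal V_{W\dot W}\times W\supseteq(\mathcal V_{W\dot W}\times\dot W)_W$; a genop if it is both a USG and an LSG. A subspace $\mathcal V_W$ is controlled invariant in $\mathcal V_{W\dot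 W}$ iff $\mathcal V_{W\dot W}\leftrightarrow(\mathcal V_W)_{\dot W}\supseteq\mathcal V_W$. *)

theory Defs
  imports Complex_Main "HOL-Library.Function_Algebras"
begin

text \<open>
  All index sets live in one universe \<open>'i\<close>. A vector on an index set \<open>X\<close> is encoded as a function
  \<open>'i \<Rightarrow> 'f\<close> that is zero outside \<open>X\<close>, so that index sets may be empty and the library notion of
  linear subspace applies to sets of vectors.
\<close>

definition vscale :: "'f::field \<Rightarrow> ('i \<Rightarrow> 'f) \<Rightarrow> 'i \<Rightarrow> 'f" where
  "vscale c f = (\<lambda>i. c * f i)"

global_interpretation vec: vector_space "vscale :: 'f::field \<Rightarrow> ('i \<Rightarrow> 'f) \<Rightarrow> 'i \<Rightarrow> 'f"
  by unfold_locales (simp_all add: vscale_def fun_eq_iff algebra_simps)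

definition vectors_on :: "'i set \<Rightarrow> ('i \<Rightarrow> 'f::field) set" where
  "vectors_on X = {f. \<forall>i. i \<notin> X \<longrightarrow> f i = 0}"

definition subspace_on :: "'i set \<Rightarrow> ('i \<Rightarrow> 'f::field) set \<Rightarrow> bool" where
  "subspace_on X V \<longleftrightarrow> V \<subseteq> vectors_on X \<and> vec.subspace V"

text \<open>
  The vector \<open>(f\<^sub>X, g\<^sub>Y)\<close> on \<open>X \<union> Y\<close>. For disjoint \<open>X\<close> and \<open>Y\<close> the order of the components is
  immaterial: \<open>vpair X Y f g = vpair Y X g f\<close>. Hence \<open>restriction V Y X\<close> below is
  \<open>\<V>\<^sub>X\<^sub>Y \<circ> Y\<close>, with \<open>V\<close> the same set as in \<open>restriction V X Y\<close>, which is \<open>\<V>\<^sub>X\<^sub>Y \<circ> X\<close>; likewise for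
  \<open>contraction\<close> (\<open>\<V>\<^sub>X\<^sub>Y \<times> X\<close>).
\<close>

definition vpair :: "'i set \<Rightarrow> 'i set \<Rightarrow> ('i \<Rightarrow> 'f) \<Rightarrow> ('i \<Rightarrow> 'f) \<Rightarrow> 'i \<Rightarrow> 'f::field" where
  "vpair X Y f g = (\<lambda>i. if i \<in> X then f i else if i \<in> Y then g i else 0)"

lemma vpair_commute: "X \<inter> Y = {} \<Longrightarrow> vpair X Y f g = vpair Y X g f"
  by (auto simp: vpair_def fun_eq_iff)

lemma vectors_on_Un:
  "vectors_on (X \<union> Y) = {vpair X Y f g |f g. f \<in> vectors_on X \<and> g \<in> vectors_on Y}"
proof (intro set_eqI iffI)
  fix h :: "'a \<Rightarrow> 'b"
  assume "h \<in> vectors_on (X \<union> Y)"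
  then have "h = vpair X Y (\<lambda>i. if i \<in> X then h i else 0) (\<lambda>i. if i \<in> Y then h i else 0)"
    by (auto simp: vectors_on_def vpair_def fun_eq_iff)
  moreover have "(\<lambda>i. if i \<in> X then h i else 0) \<in> vectors_on X"
    "(\<lambda>i. if i \<in> Y then h i else 0) \<in> vectors_on Y"
    by (simp_all add: vectors_on_def)
  ultimately show "h \<in> {vpair X Y f g |f g. f \<in> vectors_on X \<and> g \<in> vectors_on Y}"
    by blast
qed (auto simp: vectors_on_def vpair_def)

definition restriction ::
    "('i \<Rightarrow> 'f::field) set \<Rightarrow> 'i set \<Rightarrow> 'i set \<Rightarrow> ('i \<Rightarrow> 'f) set" where
  "restriction V X Y = {f \<in> vectors_on X. \<exists>g \<in> vectors_on Y. vpair X Y f g \<in> V}"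

definition contraction ::
    "('i \<Rightarrow> 'f::field) set \<Rightarrow> 'i set \<Rightarrow> 'i set \<Rightarrow> ('i \<Rightarrow> 'f) set" where
  "contraction V X Y = {f \<in> vectors_on X. vpair X Y f 0 \<in> V}"

text \<open>\<open>matched_composition V X Y U\<close> is \<open>\<V>\<^sub>X\<^sub>Y \<leftrightarrow> U\<close> for \<open>U\<close> a set of vectors on \<open>Y\<close>.\<close>

definition matched_composition ::
    "('i \<Rightarrow> 'f::field) set \<Rightarrow> 'i set \<Rightarrow> 'i set \<Rightarrow> ('i \<Rightarrow> 'f) set \<Rightarrow> ('i \<Rightarrow> 'f) set" where
  "matched_composition V X Y U = {f \<in> vectors_on X. \<exists>g \<in> U. vpair X Y f g \<in> V}"

definition direct_sum ::
    "'i set \<Rightarrow> 'i set \<Rightarrow> ('i \<Rightarrow> 'f::field) set \<Rightarrow> ('i \<Rightarrow> 'f) set \<Rightarrow> ('i \<Rightarrow> 'f) set" where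
  "direct_sum X Y U V = {vpair X Y f g |f g. f \<in> U \<and> g \<in> V}"

definition copy_of :: "'i set \<Rightarrow> 'i set \<Rightarrow> ('i \<Rightarrow> 'i) \<Rightarrow> bool" where
  "copy_of W W' d \<longleftrightarrow> finite W \<and> W \<inter> W' = {} \<and> bij_betw d W W'"

text \<open>
  For \<open>d\<close> the bijection from \<open>W\<close> to its copy \<open>W'\<close>, \<open>to_copy W W' d\<close> sends \<open>\<V>\<^sub>W\<close> to its transport
  on \<open>W'\<close>, and \<open>from_copy W d\<close> sends a set of vectors on \<open>W'\<close> to its transport on \<open>W\<close>.
\<close>

definition to_copy ::
    "'i set \<Rightarrow> 'i set \<Rightarrow> ('i \<Rightarrow> 'i) \<Rightarrow> ('i \<Rightarrow> 'f::field) set \<Rightarrow> ('i \<Rightarrow> 'f) set" where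
  "to_copy W W' d V = (\<lambda>f j. if j \<in> W' then f (inv_into W d j) else 0) ` V"

definition from_copy ::
    "'i set \<Rightarrow> ('i \<Rightarrow> 'i) \<Rightarrow> ('i \<Rightarrow> 'f::field) set \<Rightarrow> ('i \<Rightarrow> 'f) set" where
  "from_copy W d V = (\<lambda>g i. if i \<in> W then g (d i) else 0) ` V"

lemma from_copy_to_copy:
  assumes "copy_of W W' d" and "V \<subseteq> vectors_on W"
  shows "from_copy W d (to_copy W W' d V) = V"
proof -
  have "(\<lambda>i. if i \<in> W then if d i \<in> W' then f (inv_into W d (d i)) else 0 else 0) = f"
    if "f \<in> V" for f
    using assms that by (auto simp: copy_of_def vectors_on_def bij_betw_def fun_eq_iff)
  then show ?thesis
    by (simp add: from_copy_def to_copy_def image_image)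
qed

definition genaut :: "'i set \<Rightarrow> 'i set \<Rightarrow> ('i \<Rightarrow> 'f::field) set \<Rightarrow> bool" where
  "genaut W W' V \<longleftrightarrow> subspace_on (W \<union> W') V"

definition USG :: "'i set \<Rightarrow> 'i set \<Rightarrow> ('i \<Rightarrow> 'i) \<Rightarrow> ('i \<Rightarrow> 'f::field) set \<Rightarrow> bool" where
  "USG W W' d V \<longleftrightarrow>
     genaut W W' V \<and> from_copy W d (restriction V W' W) \<subseteq> restriction V W W'"

definition LSG :: "'i set \<Rightarrow> 'i set \<Rightarrow> ('i \<Rightarrow> 'i) \<Rightarrow> ('i \<Rightarrow> 'f::field) set \<Rightarrow> bool" where
  "LSG W W' d V \<longleftrightarrow>
     genaut W W' V \<and> from_copy W d (contraction V W' W) \<subseteq> contraction V W W'"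

definition genop :: "'i set \<Rightarrow> 'i set \<Rightarrow> ('i \<Rightarrow> 'i) \<Rightarrow> ('i \<Rightarrow> 'f::field) set \<Rightarrow> bool" where
  "genop W W' d V \<longleftrightarrow> USG W W' d V \<and> LSG W W' d V"

definition controlled_invariant ::
    "'i set \<Rightarrow> 'i set \<Rightarrow> ('i \<Rightarrow> 'i) \<Rightarrow> ('i \<Rightarrow> 'f::field) set \<Rightarrow> ('i \<Rightarrow> 'f) set \<Rightarrow> bool" where
  "controlled_invariant W W' d V U \<longleftrightarrow>
     subspace_on W U \<and> U \<subseteq> matched_composition V W W' (to_copy W W' d U)"

end

theory Submission
  imports Defs
begin

text \<open>
  Controlled invariance says that every \<open>f \<in> U\<close> is completed, by some \<open>g\<close> in the copy of \<open>U\<close>, to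
  an element \<open>(f, g)\<close> of \<open>V\<close>. Forgetting where \<open>g\<close> lies gives the first claim. Remembering it shows
  that \<open>(f, g)\<close> even belongs to \<open>N = V \<inter> (U \<oplus> U')\<close>, where \<open>U'\<close> is the copy of \<open>U\<close>; so the
  restriction of \<open>N\<close> to \<open>W\<close> is all of \<open>U\<close>, whereas its restriction to \<open>W'\<close> is at most \<open>U'\<close>
  (\<open>vpair_mem_direct_sum_iff\<close>). Hence \<open>N\<close> is a USG.

  For the LSG property, let \<open>(0, g) \<in> N\<close> and let \<open>f\<close> be the transport of \<open>g\<close> to \<open>W\<close>. Since \<open>V\<close> is
  an LSG, \<open>(f, 0) \<in> V\<close>; since \<open>g \<in> U'\<close>, also \<open>f \<in> U\<close>. As \<open>0 \<in> U'\<close>, the vector \<open>(f, 0)\<close> lies in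
  \<open>N\<close>. That \<open>N\<close> is a subspace follows because direct sums and transports of subspaces are subspaces.
\<close>

text \<open>
  On disjoint index sets the components of a pair are determined by the pair, so the components that
  witness membership in the direct sum can only be \<open>f\<close> and \<open>g\<close> themselves.
\<close>

lemma vpair_mem_direct_sum_iff:
  assumes "X \<inter> Y = {}" and "U \<subseteq> vectors_on X" and "V \<subseteq> vectors_on Y"
    and "f \<in> vectors_on X" and "g \<in> vectors_on Y"
  shows "vpair X Y f g \<in> direct_sum X Y U V \<longleftrightarrow> f \<in> U \<and> g \<in> V"
proof
  assume "vpair X Y f g \<in> direct_sum X Y U V"
  then obtain f' g' where eq: "vpair X Y f g = vpair X Y f' g'" and mem: "f' \<in> U" "g' \<in> V"
    by (auto simp: direct_sum_def)
  have on: "f' \<in> vectors_on X" "g' \<in> vectors_on Y"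
    using mem assms(2,3) by auto
  have "f i = f' i" for i
    using fun_cong[OF eq, of i] on assms(4)
    by (cases "i \<in> X") (auto simp: vpair_def vectors_on_def)
  moreover have "g i = g' i" for i
    using fun_cong[OF eq, of i] on assms(1,5)
    by (cases "i \<in> Y") (auto simp: vpair_def vectors_on_def split: if_splits)
  ultimately have "f = f'" "g = g'"
    by auto
  with mem show "f \<in> U \<and> g \<in> V"
    by simp
qed (auto simp: direct_sum_def)

lemma subspace_on_direct_sum:
  assumes "subspace_on X U" and "subspace_on Y V"
  shows "subspace_on (X \<union> Y) (direct_sum X Y U V)"
proof -
  have U: "vec.subspace U" and V: "vec.subspace V"
    using assms by (auto simp: subspace_on_def)
  have zero: "0 = vpair X Y 0 0"
    by (auto simp: vpair_def fun_eq_iff)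
  have add: "vpair X Y f g + vpair X Y f' g' = vpair X Y (f + f') (g + g')"
    for f g f' g' :: "'a \<Rightarrow> 'b"
    by (auto simp: vpair_def fun_eq_iff)
  have scale: "vscale c (vpair X Y f g) = vpair X Y (vscale c f) (vscale c g)"
    for c :: 'b and f g :: "'a \<Rightarrow> 'b"
    by (auto simp: vpair_def vscale_def fun_eq_iff)
  have "vec.subspace (direct_sum X Y U V)"
  proof (rule vec.subspaceI)
    show "0 \<in> direct_sum X Y U V"
      unfolding direct_sum_def using zero vec.subspace_0[OF U] vec.subspace_0[OF V] by blast
  next
    fix x y assume "x \<in> direct_sum X Y U V" "y \<in> direct_sum X Y U V"
    then show "x + y \<in> direct_sum X Y U V"
      unfolding direct_sum_def
      using add vec.subspace_add[OF U] vec.subspace_add[OF V] by blast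
  next
    fix c x assume "x \<in> direct_sum X Y U V"
    then show "vscale c x \<in> direct_sum X Y U V"
      unfolding direct_sum_def
      using scale vec.subspace_scale[OF U] vec.subspace_scale[OF V] by blast
  qed
  then show ?thesis
    by (auto simp: subspace_on_def direct_sum_def vectors_on_def vpair_def)
qed

lemma subspace_on_to_copy:
  assumes "subspace_on W U"
  shows "subspace_on W' (to_copy W W' d U)"
proof -
  have U: "vec.subspace U"
    using assms by (simp add: subspace_on_def)
  define T :: "('a \<Rightarrow> 'b) \<Rightarrow> 'a \<Rightarrow> 'b"
    where "T f = (\<lambda>j. if j \<in> W' then f (inv_into W d j) else 0)" for f
  have eq: "to_copy W W' d U = T ` U"
    by (simp add: to_copy_def T_def)
  have zero: "0 = T 0"
    by (auto simp: T_def fun_eq_iff)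
  have add: "T f + T g = T (f + g)" for f g
    by (auto simp: T_def fun_eq_iff)
  have scale: "vscale c (T f) = T (vscale c f)" for c f
    by (auto simp: T_def vscale_def fun_eq_iff)
  have "vec.subspace (T ` U)"
  proof (rule vec.subspaceI)
    show "0 \<in> T ` U"
      using zero vec.subspace_0[OF U] by blast
  next
    fix x y assume "x \<in> T ` U" "y \<in> T ` U"
    then show "x + y \<in> T ` U"
      by (auto simp: add intro: vec.subspace_add[OF U])
  next
    fix c x assume "x \<in> T ` U"
    then show "vscale c x \<in> T ` U"
      by (auto simp: scale intro: vec.subspace_scale[OF U])
  qed
  moreover have "T ` U \<subseteq> vectors_on W'"
    by (auto simp: T_def vectors_on_def)
  ultimately show ?thesis
    by (simp add: eq subspace_on_def)
qed

lemma subspace_on_Int: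
  assumes "subspace_on X U" and "subspace_on X V"
  shows "subspace_on X (U \<inter> V)"
  using assms by (auto simp: subspace_on_def vec.subspace_inter)

lemma from_copy_mono: "V \<subseteq> V' \<Longrightarrow> from_copy W d V \<subseteq> from_copy W d V'"
  by (auto simp: from_copy_def)

theorem theorem32:
  fixes W W' :: "'i set"
    and d :: "'i \<Rightarrow> 'i"
    and V U :: "('i \<Rightarrow> 'f::field) set"
  assumes "copy_of W W' d"
    and "genaut W W' V"
    and "controlled_invariant W W' d V U"
  shows "U \<subseteq> restriction V W W' \<and>
    (LSG W W' d V \<longrightarrow> genop W W' d (V \<inter> direct_sum W W' U (to_copy W W' d U)))"
proof (intro conjI impI)
  define U' where "U' = to_copy W W' d U"
  define N where "N = V \<inter> direct_sum W W' U U'"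
  have disj: "W \<inter> W' = {}"
    using assms(1) by (simp add: copy_of_def)
  have subU: "subspace_on W U" and inv: "U \<subseteq> matched_composition V W W' U'"
    using assms(3) by (simp_all add: controlled_invariant_def U'_def)
  have subU': "subspace_on W' U'"
    unfolding U'_def by (rule subspace_on_to_copy[OF subU])
  have U: "U \<subseteq> vectors_on W" and U': "U' \<subseteq> vectors_on W'" and U'0: "0 \<in> U'"
    using subU subU' vec.subspace_0 by (auto simp: subspace_on_def)
  have from_copy_U': "from_copy W d U' = U"
    unfolding U'_def by (rule from_copy_to_copy[OF assms(1) U])
  have sum_iff: "vpair W W' f g \<in> direct_sum W W' U U' \<longleftrightarrow> f \<in> U \<and> g \<in> U'"
    if "f \<in> vectors_on W" "g \<in> vectors_on W'" for f g
    using vpair_mem_direct_sum_iff[OF disj U U' that] .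
  have zero_on: "0 \<in> vectors_on X" for X :: "'i set"
    by (simp add: vectors_on_def)
  have swap: "vpair W' W g f = vpair W W' f g" for f g :: "'i \<Rightarrow> 'f"
    by (rule vpair_commute[OF disj, symmetric])

  have U_restr: "U \<subseteq> restriction N W W'"
  proof
    fix f assume f: "f \<in> U"
    then obtain g where "g \<in> U'" "vpair W W' f g \<in> V"
      using inv by (auto simp: matched_composition_def)
    with f U U' show "f \<in> restriction N W W'"
      by (auto simp: restriction_def N_def direct_sum_def)
  qed
  then show "U \<subseteq> restriction V W W'"
    by (auto simp: restriction_def N_def)

  assume LSG: "LSG W W' d V"
  have genaut: "genaut W W' N"
    using assms(2) subspace_on_Int subspace_on_direct_sum[OF subU subU']
    by (auto simp: genaut_def N_def)
  have "restriction N W' W \<subseteq> U'"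
    by (auto simp: restriction_def N_def swap sum_iff)
  then have "from_copy W d (restriction N W' W) \<subseteq> U"
    using from_copy_mono[of "restriction N W' W" U' W d] from_copy_U' by simp
  with U_restr have "from_copy W d (restriction N W' W) \<subseteq> restriction N W W'"
    by blast
  moreover have "from_copy W d (contraction N W' W) \<subseteq> contraction N W W'"
  proof -
    have contr: "contraction N W' W \<subseteq> contraction V W' W" "contraction N W' W \<subseteq> U'"
      by (auto simp: contraction_def N_def swap sum_iff zero_on)
    have "from_copy W d (contraction N W' W) \<subseteq> contraction V W W'"
      using order_trans[OF from_copy_mono[OF contr(1)]] LSG by (simp add: LSG_def)
    moreover have "from_copy W d (contraction N W' W) \<subseteq> U"
      using from_copy_mono[OF contr(2), of W d] from_copy_U' by simp
    moreover have "contraction V W W' \<inter> U \<subseteq> contraction N W W'"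
      using U'0 by (auto simp: contraction_def N_def sum_iff zero_on)
    ultimately show ?thesis
      by (meson Int_greatest order_trans)
  qed
  ultimately have "genop W W' d N"
    using genaut by (simp add: genop_def USG_def LSG_def)
  then show "genop W W' d (V \<inter> direct_sum W W' U (to_copy W W' d U))"
    by (simp only: N_def U'_def)
qed

end
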